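(* Let $(X,\mu)$ be a discrete measure space and let $T\colon X\to X$ be a map such that $h_T\in L^\infty(\mu)$ and $G_T$ is connected and of one-cycle type. Then the following conditions are equivalent: (i) $S_{\lambda_T}$ is $2$-isometric; (ii) $S_{\lambda_T}$ is completely hyperexpansive.
   Context: A discrete measure space is a pair $(X,\mu)$ with $X$ an at most countable (non-empty) set and $\mu\colon 2^X\to[0,\infty]$ a measure with $\mu(x):=\mu(\{x\})\in(0,\infty)$ for all $x\in X$. For $T\colon X\to X$ put $h_T(x)=\mu(T^{-1}(\{x\}))/\mu(x)$. The graph $G_T=(V_T,E_T)$ has $V_T=X$ and $E_T=\{(Tx,x):x\in X\}$. For $v\in V_T$ put $\lambda_v=\sqrt{\mu(v)}/\sqrt{\mu(Tv)}$. If $h_T\in L^\infty(\mu)$, then $S_{\lambda_T}$ is the bounded linear operator on the complex Hilbert space $\ell^2(V_T)$, with standard orthonormal basis $(e_v)_{v\in V_T}$, given by $S_{\lambda_T}e_u=\sum_{v\in V_T,\,Tv=u}\lambda_v e_v$. A graph is connected if any two distinct vertices can be joined by a finite sequence of vertices in which consecutive ones are joined by an edge in one direction or the other. A directed tree is a connected directed graph with every in-degree at most $1$ and no cycle (path $(u_0,\ldots,u_k)$, $k\ge1$, with $u_0=u_k$); its root, if it exists, is its unique vertex of in-degree $0$, and the tree is then called rooted. $G_T$ is of one-cycle type if: (a) there are $\kappa\ge1$ and distinct vertices $v_0,\ldots,v_{\kappa-1}\in V_T$ with $(v_j,v_{j+1})\in E_T$ for $0\le j\le\kappa-2$ and $(v_{\kappa-1},v_0)\in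 E_T$; (b) there is a partition $\mathcal R$ of $V_T\setminus\{v_0,\ldots,v_{\kappa-1}\}$ such that for every $R\in\mathcal R$ the graph $(R,E_T\cap(R\times R))$ is a rooted directed tree whose root $\omega_R$ has the property that there is exactly one $i_R\in\{0,\ldots,\kappa-1\}$ with $(v_{i_R},\omega_R)\in E_T$. An operator $S\in\mathbf B(H)$ is $2$-isometric if $I-2S^*S+S^{*2}S^2=0$, and completely hyperexpansive if $\sum_{k=0}^n(-1)^k\binom nk S^{*k}S^k\le0$ for every integer $n\ge1$. *)

theory Defs
  imports "HOL-Analysis.Analysis"
begin

section \<open>The Hilbert space \<open>\<ell>\<^sup>2(X)\<close> and its bounded operators\<close>

text \<open>
  Vectors of \<open>\<ell>\<^sup>2(X)\<close> are functions on the whole type that vanish outside \<open>X\<close>, so that equality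
  of vectors is equality of functions.
\<close>

definition ell2 :: "'a set \<Rightarrow> ('a \<Rightarrow> complex) set" where
  "ell2 X = {f. (\<forall>x. x \<notin> X \<longrightarrow> f x = 0) \<and> (\<lambda>x. (cmod (f x))\<^sup>2) summable_on X}"

definition ell2_inner :: "'a set \<Rightarrow> ('a \<Rightarrow> complex) \<Rightarrow> ('a \<Rightarrow> complex) \<Rightarrow> complex" where
  "ell2_inner X f g = (\<Sum>\<^sub>\<infinity>x\<in>X. f x * cnj (g x))"

definition ell2_norm :: "'a set \<Rightarrow> ('a \<Rightarrow> complex) \<Rightarrow> real" where
  "ell2_norm X f = sqrt (\<Sum>\<^sub>\<infinity>x\<in>X. (cmod (f x))\<^sup>2)"

definition ell2_basis :: "'a \<Rightarrow> 'a \<Rightarrow> complex" where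
  "ell2_basis v = (\<lambda>x. if x = v then 1 else 0)"

text \<open>Unconditional summation of a family of vectors with respect to the norm of \<open>\<ell>\<^sup>2(X)\<close>.\<close>

definition ell2_has_sum ::
  "'a set \<Rightarrow> ('i \<Rightarrow> 'a \<Rightarrow> complex) \<Rightarrow> ('a \<Rightarrow> complex) \<Rightarrow> 'i set \<Rightarrow> bool" where
  "ell2_has_sum X g f I \<longleftrightarrow> f \<in> ell2 X \<and>
     ((\<lambda>F. ell2_norm X (\<lambda>x. f x - (\<Sum>i\<in>F. g i x))) \<longlongrightarrow> 0) (finite_subsets_at_top I)"

text \<open>
  The space \<open>B(\<ell>\<^sup>2(X))\<close>.  The last clause fixes the junk values outside \<open>\<ell>\<^sup>2(X)\<close>, so that an operator
  is determined by its restriction to \<open>\<ell>\<^sup>2(X)\<close>.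
\<close>

definition bounded_op :: "'a set \<Rightarrow> (('a \<Rightarrow> complex) \<Rightarrow> ('a \<Rightarrow> complex)) \<Rightarrow> bool" where
  "bounded_op X S \<longleftrightarrow>
     (\<forall>f\<in>ell2 X. S f \<in> ell2 X) \<and>
     (\<forall>f\<in>ell2 X. \<forall>g\<in>ell2 X. S (\<lambda>x. f x + g x) = (\<lambda>x. S f x + S g x)) \<and>
     (\<forall>c. \<forall>f\<in>ell2 X. S (\<lambda>x. c * f x) = (\<lambda>x. c * S f x)) \<and>
     (\<exists>C. \<forall>f\<in>ell2 X. ell2_norm X (S f) \<le> C * ell2_norm X f) \<and>
     (\<forall>f. f \<notin> ell2 X \<longrightarrow> S f = (\<lambda>x. 0))"

definition op_adjoint ::
  "'a set \<Rightarrow> (('a \<Rightarrow> complex) \<Rightarrow> ('a \<Rightarrow> complex)) \<Rightarrow> ('a \<Rightarrow> complex) \<Rightarrow> ('a \<Rightarrow> complex)" where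
  "op_adjoint X S = (THE R. bounded_op X R \<and>
     (\<forall>f\<in>ell2 X. \<forall>g\<in>ell2 X. ell2_inner X (S f) g = ell2_inner X f (R g)))"

definition nonpositive_op :: "'a set \<Rightarrow> (('a \<Rightarrow> complex) \<Rightarrow> ('a \<Rightarrow> complex)) \<Rightarrow> bool" where
  "nonpositive_op X A \<longleftrightarrow>
     (\<forall>f\<in>ell2 X. ell2_inner X (A f) f \<in> \<real> \<and> Re (ell2_inner X (A f) f) \<le> 0)"

definition two_isometric :: "'a set \<Rightarrow> (('a \<Rightarrow> complex) \<Rightarrow> ('a \<Rightarrow> complex)) \<Rightarrow> bool" where
  "two_isometric X S \<longleftrightarrow> (let S' = op_adjoint X S in
     \<forall>f\<in>ell2 X. (\<lambda>x. f x - 2 * S' (S f) x + (S' ^^ 2) ((S ^^ 2) f) x) = (\<lambda>x. 0))"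

definition completely_hyperexpansive ::
  "'a set \<Rightarrow> (('a \<Rightarrow> complex) \<Rightarrow> ('a \<Rightarrow> complex)) \<Rightarrow> bool" where
  "completely_hyperexpansive X S \<longleftrightarrow> (let S' = op_adjoint X S in
     \<forall>n\<ge>1. nonpositive_op X
       (\<lambda>f x. \<Sum>k\<le>n. (-1) ^ k * of_nat (n choose k) * (S' ^^ k) ((S ^^ k) f) x))"

section \<open>Directed graphs\<close>

text \<open>
  A directed graph is given by a vertex set \<open>V\<close> and an edge relation \<open>E \<subseteq> V \<times> V\<close>;
  \<open>(u, v) \<in> E\<close> is an edge from \<open>u\<close> to \<open>v\<close>.  Loops and infinite graphs are allowed.
\<close>

definition graph_connected :: "'a set \<Rightarrow> ('a \<times> 'a) set \<Rightarrow> bool" where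
  "graph_connected V E \<longleftrightarrow> (\<forall>u\<in>V. \<forall>v\<in>V. u \<noteq> v \<longrightarrow> (u, v) \<in> (E \<union> E\<inverse>)\<^sup>*)"

definition in_neighbours :: "('a \<times> 'a) set \<Rightarrow> 'a \<Rightarrow> 'a set" where
  "in_neighbours E v = {u. (u, v) \<in> E}"

text \<open>
  Finiteness is part of ``in-degree at most \<open>1\<close>'', since \<^const>\<open>card\<close> is \<open>0\<close> on infinite sets.
  \<^const>\<open>acyclic\<close> excludes precisely the paths \<open>(u\<^sub>0, \<dots>, u\<^sub>k)\<close> with \<open>k \<ge> 1\<close> and \<open>u\<^sub>0 = u\<^sub>k\<close>,
  in particular loops.
\<close>

definition directed_tree :: "'a set \<Rightarrow> ('a \<times> 'a) set \<Rightarrow> bool" where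
  "directed_tree V E \<longleftrightarrow> E \<subseteq> V \<times> V \<and> graph_connected V E \<and>
     (\<forall>v\<in>V. finite (in_neighbours E v) \<and> card (in_neighbours E v) \<le> 1) \<and> acyclic E"

definition rooted_directed_tree :: "'a set \<Rightarrow> ('a \<times> 'a) set \<Rightarrow> 'a \<Rightarrow> bool" where
  "rooted_directed_tree V E r \<longleftrightarrow> directed_tree V E \<and>
     r \<in> V \<and> in_neighbours E r = {} \<and> (\<forall>w\<in>V. in_neighbours E w = {} \<longrightarrow> w = r)"

definition one_cycle_type :: "'a set \<Rightarrow> ('a \<times> 'a) set \<Rightarrow> bool" where
  "one_cycle_type V E \<longleftrightarrow>
     (\<exists>(\<kappa>::nat) v. \<kappa> \<ge> 1 \<and> inj_on v {..<\<kappa>} \<and> v ` {..<\<kappa>} \<subseteq> V \<and>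
        (\<forall>j. j + 1 < \<kappa> \<longrightarrow> (v j, v (j + 1)) \<in> E) \<and> (v (\<kappa> - 1), v 0) \<in> E \<and>
        (\<exists>\<R>. partition_on (V - v ` {..<\<kappa>}) \<R> \<and>
           (\<forall>R\<in>\<R>. \<exists>\<omega>. rooted_directed_tree R (E \<inter> (R \<times> R)) \<omega> \<and>
              (\<exists>!i. i < \<kappa> \<and> (v i, \<omega>) \<in> E))))"

section \<open>Discrete measure spaces and the weighted shift of a self-map\<close>

definition discrete_measure_space :: "'a measure \<Rightarrow> bool" where
  "discrete_measure_space M \<longleftrightarrow>
     countable (space M) \<and> space M \<noteq> {} \<and> sets M = Pow (space M) \<and>
     (\<forall>x\<in>space M. 0 < emeasure M {x} \<and> emeasure M {x} < \<infinity>)"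

definition h_fun :: "'a measure \<Rightarrow> ('a \<Rightarrow> 'a) \<Rightarrow> 'a \<Rightarrow> ennreal" where
  "h_fun M T x = emeasure M (T -` {x} \<inter> space M) / emeasure M {x}"

definition Linfty :: "'a measure \<Rightarrow> ('a \<Rightarrow> ennreal) set" where
  "Linfty M = {f \<in> borel_measurable M. \<exists>C::real. AE x in M. f x \<le> ennreal C}"

definition graph_edges :: "'a measure \<Rightarrow> ('a \<Rightarrow> 'a) \<Rightarrow> ('a \<times> 'a) set" where
  "graph_edges M T = {(T x, x) | x. x \<in> space M}"

definition weight :: "'a measure \<Rightarrow> ('a \<Rightarrow> 'a) \<Rightarrow> 'a \<Rightarrow> real" where
  "weight M T v = sqrt (measure M {v}) / sqrt (measure M {T v})"

definition weighted_shift ::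
  "'a measure \<Rightarrow> ('a \<Rightarrow> 'a) \<Rightarrow> ('a \<Rightarrow> complex) \<Rightarrow> ('a \<Rightarrow> complex)" where
  "weighted_shift M T = (THE S. bounded_op (space M) S \<and>
     (\<forall>u\<in>space M. ell2_has_sum (space M)
        (\<lambda>v x. complex_of_real (weight M T v) * ell2_basis v x)
        (S (ell2_basis u)) {v \<in> space M. T v = u}))"

section \<open>Existence and uniqueness for \<open>op_adjoint\<close> and \<open>weighted_shift\<close>\<close>

lemma ell2I:
  assumes "\<And>x. x \<notin> X \<Longrightarrow> f x = 0" "\<And>F. finite F \<Longrightarrow> F \<subseteq> X \<Longrightarrow> (\<Sum>x\<in>F. (cmod (f x))\<^sup>2) \<le> B"
  shows "f \<in> ell2 X"
proof -
  have "(\<lambda>x. (cmod (f x))\<^sup>2) summable_on X"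
    by (rule nonneg_bdd_above_summable_on) (use assms(2) in \<open>auto intro!: bdd_aboveI2[where M = B]\<close>)
  then show ?thesis using assms(1) by (auto simp: ell2_def)
qed

lemma ell2_norm_le:
  assumes "\<And>F. finite F \<Longrightarrow> F \<subseteq> X \<Longrightarrow> (\<Sum>x\<in>F. (cmod (f x))\<^sup>2) \<le> B\<^sup>2" "B \<ge> 0" "f \<in> ell2 X"
  shows "ell2_norm X f \<le> B"
proof -
  have "(\<Sum>\<^sub>\<infinity>x\<in>X. (cmod (f x))\<^sup>2) \<le> B\<^sup>2"
    by (rule infsum_le_finite_sums) (use assms in \<open>auto simp: ell2_def\<close>)
  then show ?thesis unfolding ell2_norm_def using assms(2) real_le_lsqrt by simp
qed

lemma ell2_norm_nonneg: "ell2_norm X f \<ge> 0"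
  unfolding ell2_norm_def by (simp add: infsum_nonneg)

lemma ell2_norm_sum_le:
  assumes "f \<in> ell2 X" "finite F" "F \<subseteq> X"
  shows "(\<Sum>x\<in>F. (cmod (f x))\<^sup>2) \<le> (ell2_norm X f)\<^sup>2"
proof -
  have "(\<Sum>x\<in>F. (cmod (f x))\<^sup>2) \<le> (\<Sum>\<^sub>\<infinity>x\<in>X. (cmod (f x))\<^sup>2)"
    by (rule finite_sum_le_infsum) (use assms in \<open>auto simp: ell2_def\<close>)
  then show ?thesis unfolding ell2_norm_def by (simp add: infsum_nonneg)
qed

lemma ell2_norm_pointwise:
  assumes "f \<in> ell2 X" shows "cmod (f x) \<le> ell2_norm X f"
proof (cases "x \<in> X")
  case True
  then have "(cmod (f x))\<^sup>2 \<le> (ell2_norm X f)\<^sup>2" using ell2_norm_sum_le[OF assms, of "{x}"] by simp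
  then show ?thesis by (rule power2_le_imp_le) (rule ell2_norm_nonneg)
next
  case False
  then show ?thesis using assms ell2_norm_nonneg by (auto simp: ell2_def)
qed

lemma ell2_add:
  assumes "f \<in> ell2 X" "g \<in> ell2 X" shows "(\<lambda>x. f x + g x) \<in> ell2 X"
proof (rule ell2I[where B = "2 * (ell2_norm X f)\<^sup>2 + 2 * (ell2_norm X g)\<^sup>2"])
  fix F assume F: "finite F" "F \<subseteq> X"
  have "(cmod (f x + g x))\<^sup>2 \<le> 2 * (cmod (f x))\<^sup>2 + 2 * (cmod (g x))\<^sup>2" for x
  proof -
    have "(cmod (f x + g x))\<^sup>2 \<le> (cmod (f x) + cmod (g x))\<^sup>2"
      by (intro power_mono norm_triangle_ineq) auto
    also have "\<dots> \<le> 2 * (cmod (f x))\<^sup>2 + 2 * (cmod (g x))\<^sup>2"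
      using sum_squares_bound[of "cmod (f x)" "cmod (g x)"] by (simp add: power2_sum)
    finally show ?thesis .
  qed
  then have "(\<Sum>x\<in>F. (cmod (f x + g x))\<^sup>2) \<le> (\<Sum>x\<in>F. 2 * (cmod (f x))\<^sup>2 + 2 * (cmod (g x))\<^sup>2)"
    by (rule sum_mono)
  also have "\<dots> = 2 * (\<Sum>x\<in>F. (cmod (f x))\<^sup>2) + 2 * (\<Sum>x\<in>F. (cmod (g x))\<^sup>2)"
    by (simp add: sum.distrib sum_distrib_left)
  also have "\<dots> \<le> 2 * (ell2_norm X f)\<^sup>2 + 2 * (ell2_norm X g)\<^sup>2"
    using ell2_norm_sum_le[OF assms(1) F] ell2_norm_sum_le[OF assms(2) F] by simp
  finally show "(\<Sum>x\<in>F. (cmod (f x + g x))\<^sup>2) \<le> 2 * (ell2_norm X f)\<^sup>2 + 2 * (ell2_norm X g)\<^sup>2" .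
qed (use assms in \<open>auto simp: ell2_def\<close>)

lemma ell2_scale:
  assumes "f \<in> ell2 X" shows "(\<lambda>x. c * f x) \<in> ell2 X"
  using assms by (auto simp: ell2_def norm_mult power_mult_distrib intro!: summable_on_cmult_right)

lemma ell2_diff:
  assumes "f \<in> ell2 X" "g \<in> ell2 X" shows "(\<lambda>x. f x - g x) \<in> ell2 X"
  using ell2_add[OF assms(1) ell2_scale[OF assms(2), of "-1"]] by simp

lemma ell2_zero: "(\<lambda>x. 0) \<in> ell2 X"
  by (rule ell2I[where B = 0]) auto

lemma ell2_sum:
  assumes "finite F" "\<And>i. i \<in> F \<Longrightarrow> g i \<in> ell2 X" shows "(\<lambda>x. \<Sum>i\<in>F. g i x) \<in> ell2 X"
  using assms by (induction F rule: finite_induct) (auto intro: ell2_zero ell2_add)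

lemma ell2_basis_mem: "v \<in> X \<Longrightarrow> ell2_basis v \<in> ell2 X"
proof (rule ell2I[where B = 1])
  fix F assume F: "finite (F :: 'a set)" "v \<in> X" "F \<subseteq> X"
  have "(\<Sum>x\<in>F. (cmod (ell2_basis v x))\<^sup>2) = (\<Sum>x\<in>F. if x = v then 1 else 0)"
    by (rule sum.cong) (auto simp: ell2_basis_def)
  then show "(\<Sum>x\<in>F. (cmod (ell2_basis v x))\<^sup>2) \<le> 1" using F by simp
qed (auto simp: ell2_basis_def)

lemma ell2_inner_abs_summable:
  assumes "f \<in> ell2 X" "g \<in> ell2 X" shows "(\<lambda>x. norm (f x * cnj (g x))) summable_on X"
proof (rule summable_on_comparison_test[where f = "\<lambda>x. (cmod (f x))\<^sup>2 + (cmod (g x))\<^sup>2"])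
  show "(\<lambda>x. (cmod (f x))\<^sup>2 + (cmod (g x))\<^sup>2) summable_on X"
    using assms by (intro summable_on_add) (auto simp: ell2_def)
  fix x
  have "2 * (cmod (f x) * cmod (g x)) \<le> (cmod (f x))\<^sup>2 + (cmod (g x))\<^sup>2"
    using sum_squares_bound[of "cmod (f x)" "cmod (g x)"] by simp
  moreover have "0 \<le> cmod (f x) * cmod (g x)" by simp
  ultimately show "norm (f x * cnj (g x)) \<le> (cmod (f x))\<^sup>2 + (cmod (g x))\<^sup>2"
    unfolding norm_mult complex_mod_cnj by linarith
qed simp

lemma ell2_inner_has_sum:
  assumes "f \<in> ell2 X" "g \<in> ell2 X"
  shows "((\<lambda>x. f x * cnj (g x)) has_sum ell2_inner X f g) X"
  unfolding ell2_inner_def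
  using abs_summable_summable[OF ell2_inner_abs_summable[OF assms]] by simp

lemma ell2_Cauchy_Schwarz:
  assumes "f \<in> ell2 X" "g \<in> ell2 X"
  shows "cmod (ell2_inner X f g) \<le> ell2_norm X f * ell2_norm X g"
proof -
  have "cmod (ell2_inner X f g) \<le> (\<Sum>\<^sub>\<infinity>x\<in>X. norm (f x * cnj (g x)))"
    unfolding ell2_inner_def by (rule norm_infsum_bound[OF ell2_inner_abs_summable[OF assms]])
  also have "\<dots> \<le> ell2_norm X f * ell2_norm X g"
  proof (rule infsum_le_finite_sums[OF ell2_inner_abs_summable[OF assms]])
    fix F assume F: "finite F" "F \<subseteq> X"
    have "(\<Sum>x\<in>F. norm (f x * cnj (g x))) = (\<Sum>x\<in>F. \<bar>cmod (f x)\<bar> * \<bar>cmod (g x)\<bar>)"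
      by (simp add: norm_mult)
    also have "\<dots> \<le> L2_set (\<lambda>x. cmod (f x)) F * L2_set (\<lambda>x. cmod (g x)) F"
      by (rule L2_set_mult_ineq)
    also have "\<dots> \<le> ell2_norm X f * ell2_norm X g"
      unfolding L2_set_def
      using ell2_norm_sum_le[OF assms(1) F] ell2_norm_sum_le[OF assms(2) F]
      by (intro mult_mono real_le_lsqrt) (auto simp: ell2_norm_nonneg sum_nonneg)
    finally show "(\<Sum>x\<in>F. norm (f x * cnj (g x))) \<le> ell2_norm X f * ell2_norm X g" .
  qed
  finally show ?thesis .
qed

lemma ell2_inner_basis:
  assumes "f \<in> ell2 X" "v \<in> X"
  shows "ell2_inner X f (ell2_basis v) = f v" "ell2_inner X (ell2_basis v) f = cnj (f v)"
proof -
  have "ell2_inner X f (ell2_basis v) = (\<Sum>\<^sub>\<infinity>x\<in>{v}. f x * cnj (ell2_basis v x))"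
    unfolding ell2_inner_def by (rule infsum_cong_neutral) (use assms in \<open>auto simp: ell2_basis_def\<close>)
  then show "ell2_inner X f (ell2_basis v) = f v" by (simp add: ell2_basis_def)
  have "ell2_inner X (ell2_basis v) f = (\<Sum>\<^sub>\<infinity>x\<in>{v}. ell2_basis v x * cnj (f x))"
    unfolding ell2_inner_def by (rule infsum_cong_neutral) (use assms in \<open>auto simp: ell2_basis_def\<close>)
  then show "ell2_inner X (ell2_basis v) f = cnj (f v)" by (simp add: ell2_basis_def)
qed

lemma ell2_basis_expansion:
  assumes "f \<in> ell2 X"
  shows "ell2_has_sum X (\<lambda>v x. f v * ell2_basis v x) f X"
proof -
  let ?s = "\<lambda>F. \<Sum>x\<in>F. (cmod (f x))\<^sup>2" and ?I = "\<Sum>\<^sub>\<infinity>x\<in>X. (cmod (f x))\<^sup>2"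
  have sm: "(\<lambda>x. (cmod (f x))\<^sup>2) summable_on X" using assms by (auto simp: ell2_def)
  have eq: "ell2_norm X (\<lambda>x. f x - (\<Sum>v\<in>F. f v * ell2_basis v x)) = sqrt (?I - ?s F)"
    if F: "finite F" "F \<subseteq> X" for F
  proof -
    have val: "f x - (\<Sum>v\<in>F. f v * ell2_basis v x) = (if x \<in> F then 0 else f x)" for x
      using F(1) by (simp add: ell2_basis_def if_distrib[of "\<lambda>y. _ * y"] cong: if_cong)
    have "(\<Sum>\<^sub>\<infinity>x\<in>X. (cmod (f x - (\<Sum>v\<in>F. f v * ell2_basis v x)))\<^sup>2) = (\<Sum>\<^sub>\<infinity>x\<in>X - F. (cmod (f x))\<^sup>2)"
      unfolding val by (rule infsum_cong_neutral) auto
    also have "\<dots> = ?I - (\<Sum>\<^sub>\<infinity>x\<in>F. (cmod (f x))\<^sup>2)"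
      by (rule infsum_Diff) (use F sm in auto)
    finally show ?thesis using F by (simp add: ell2_norm_def)
  qed
  have "(?s \<longlongrightarrow> ?I) (finite_subsets_at_top X)" using sm by (rule infsum_tendsto)
  then have "((\<lambda>F. sqrt (?I - ?s F)) \<longlongrightarrow> sqrt (?I - ?I)) (finite_subsets_at_top X)"
    by (intro tendsto_intros)
  then have "((\<lambda>F. sqrt (?I - ?s F)) \<longlongrightarrow> 0) (finite_subsets_at_top X)" by simp
  then have "((\<lambda>F. ell2_norm X (\<lambda>x. f x - (\<Sum>v\<in>F. f v * ell2_basis v x))) \<longlongrightarrow> 0)
      (finite_subsets_at_top X)"
    by (rule Lim_transform_eventually)
      (auto intro!: eventually_finite_subsets_at_top_weakI simp: eq)
  then show ?thesis using assms by (auto simp: ell2_has_sum_def)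
qed

lemma ell2_has_sum_pointwise:
  assumes "ell2_has_sum X g f I" "\<And>i. i \<in> I \<Longrightarrow> g i \<in> ell2 X"
  shows "((\<lambda>i. g i x) has_sum f x) I"
proof -
  have f: "f \<in> ell2 X" and lim:
    "((\<lambda>F. ell2_norm X (\<lambda>x. f x - (\<Sum>i\<in>F. g i x))) \<longlongrightarrow> 0) (finite_subsets_at_top I)"
    using assms(1) by (auto simp: ell2_has_sum_def)
  have "((\<lambda>F. f x - (\<Sum>i\<in>F. g i x)) \<longlongrightarrow> 0) (finite_subsets_at_top I)"
  proof (rule Lim_null_comparison[OF _ lim], rule eventually_finite_subsets_at_top_weakI)
    fix F assume "finite F" "F \<subseteq> I"
    then have "(\<lambda>x. f x - (\<Sum>i\<in>F. g i x)) \<in> ell2 X"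
      using assms(2) by (intro ell2_diff ell2_sum f) auto
    from ell2_norm_pointwise[OF this]
    show "norm (f x - (\<Sum>i\<in>F. g i x)) \<le> ell2_norm X (\<lambda>x. f x - (\<Sum>i\<in>F. g i x))" .
  qed
  from tendsto_diff[OF tendsto_const[of "f x"] this] show ?thesis by (simp add: has_sum_def)
qed

lemma bounded_op_bound:
  assumes "bounded_op X S"
  obtains C where "C \<ge> 0" "\<And>f. f \<in> ell2 X \<Longrightarrow> ell2_norm X (S f) \<le> C * ell2_norm X f"
proof -
  obtain C where C: "\<And>f. f \<in> ell2 X \<Longrightarrow> ell2_norm X (S f) \<le> C * ell2_norm X f"
    using assms unfolding bounded_op_def by blast
  have "ell2_norm X (S f) \<le> max C 0 * ell2_norm X f" if "f \<in> ell2 X" for f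
    using C[OF that] mult_right_mono[of C "max C 0" "ell2_norm X f"] ell2_norm_nonneg[of X f]
    by linarith
  then show thesis using that[of "max C 0"] by simp
qed

lemma bounded_op_mem: "bounded_op X S \<Longrightarrow> f \<in> ell2 X \<Longrightarrow> S f \<in> ell2 X"
  by (auto simp: bounded_op_def)

lemma bounded_op_add:
  "bounded_op X S \<Longrightarrow> f \<in> ell2 X \<Longrightarrow> g \<in> ell2 X \<Longrightarrow> S (\<lambda>x. f x + g x) = (\<lambda>x. S f x + S g x)"
  by (simp add: bounded_op_def)

lemma bounded_op_scale:
  "bounded_op X S \<Longrightarrow> f \<in> ell2 X \<Longrightarrow> S (\<lambda>x. c * f x) = (\<lambda>x. c * S f x)"
  by (simp add: bounded_op_def)

lemma bounded_op_sum:
  assumes "bounded_op X S" "finite F" "\<And>i. i \<in> F \<Longrightarrow> g i \<in> ell2 X"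
  shows "S (\<lambda>x. \<Sum>i\<in>F. g i x) = (\<lambda>x. \<Sum>i\<in>F. S (g i) x)"
  using assms(2,3)
proof (induction F rule: finite_induct)
  case empty
  show ?case using bounded_op_scale[OF assms(1) ell2_zero, of 0] by simp
next
  case (insert a F)
  have "S (\<lambda>x. g a x + (\<Sum>i\<in>F. g i x)) = (\<lambda>x. S (g a) x + S (\<lambda>x. \<Sum>i\<in>F. g i x) x)"
    using insert by (intro bounded_op_add[OF assms(1)] ell2_sum) auto
  then show ?case using insert by simp
qed

lemma bounded_op_diff:
  assumes "bounded_op X S" "f \<in> ell2 X" "g \<in> ell2 X"
  shows "S (\<lambda>x. f x - g x) = (\<lambda>x. S f x - S g x)"
proof -
  show ?thesis
    using bounded_op_add[OF assms(1,2) ell2_scale[OF assms(3), of "-1"]]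
      bounded_op_scale[OF assms(1,3), of "-1"] by simp
qed

lemma bounded_op_basis_expansion:
  assumes S: "bounded_op X S" and f: "f \<in> ell2 X"
  shows "ell2_has_sum X (\<lambda>v x. f v * S (ell2_basis v) x) (S f) X"
proof -
  obtain C where C: "C \<ge> 0" "\<And>f. f \<in> ell2 X \<Longrightarrow> ell2_norm X (S f) \<le> C * ell2_norm X f"
    using bounded_op_bound[OF S] by blast
  let ?d = "\<lambda>F x. f x - (\<Sum>v\<in>F. f v * ell2_basis v x)"
  have "((\<lambda>F. ell2_norm X (?d F)) \<longlongrightarrow> 0) (finite_subsets_at_top X)"
    using ell2_basis_expansion[OF f] by (auto simp: ell2_has_sum_def)
  then have lim: "((\<lambda>F. C * ell2_norm X (?d F)) \<longlongrightarrow> 0) (finite_subsets_at_top X)"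
    by (rule tendsto_mult_right_zero)
  have "((\<lambda>F. ell2_norm X (\<lambda>x. S f x - (\<Sum>v\<in>F. f v * S (ell2_basis v) x))) \<longlongrightarrow> 0)
      (finite_subsets_at_top X)"
  proof (rule Lim_null_comparison[OF _ lim], rule eventually_finite_subsets_at_top_weakI)
    fix F assume F: "finite F" "F \<subseteq> X"
    have mem: "(\<lambda>x. f v * ell2_basis v x) \<in> ell2 X" if "v \<in> F" for v
      using that F by (intro ell2_scale ell2_basis_mem) auto
    have sc: "S (\<lambda>x. f v * ell2_basis v x) = (\<lambda>x. f v * S (ell2_basis v) x)" if "v \<in> F" for v
      using that F by (intro bounded_op_scale[OF S] ell2_basis_mem) auto
    have "S (\<lambda>x. \<Sum>v\<in>F. f v * ell2_basis v x) = (\<lambda>x. \<Sum>v\<in>F. S (\<lambda>x. f v * ell2_basis v x) x)"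
      by (rule bounded_op_sum[OF S F(1) mem])
    also have "\<dots> = (\<lambda>x. \<Sum>v\<in>F. f v * S (ell2_basis v) x)"
      using sc by (intro ext sum.cong) auto
    finally have "(\<lambda>x. S f x - (\<Sum>v\<in>F. f v * S (ell2_basis v) x)) = S (?d F)"
      using bounded_op_diff[OF S f ell2_sum[OF F(1) mem]] by simp
    moreover have "?d F \<in> ell2 X" using F mem by (intro ell2_diff ell2_sum f) auto
    ultimately show "norm (ell2_norm X (\<lambda>x. S f x - (\<Sum>v\<in>F. f v * S (ell2_basis v) x)))
        \<le> C * ell2_norm X (?d F)"
      using C(2) ell2_norm_nonneg[of X] by simp
  qed
  then show ?thesis using bounded_op_mem[OF S f] by (simp add: ell2_has_sum_def)
qed

lemma bounded_op_eqI:
  assumes S: "bounded_op X S" and R: "bounded_op X R"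
    and eq: "\<And>v. v \<in> X \<Longrightarrow> S (ell2_basis v) = R (ell2_basis v)"
  shows "S = R"
proof (intro ext)
  fix f x show "S f x = R f x"
  proof (cases "f \<in> ell2 X")
    case True
    have "((\<lambda>v. f v * S (ell2_basis v) x) has_sum S f x) X"
      by (rule ell2_has_sum_pointwise[OF bounded_op_basis_expansion[OF S True]])
        (intro ell2_scale bounded_op_mem[OF S] ell2_basis_mem)
    moreover have "((\<lambda>v. f v * R (ell2_basis v) x) has_sum R f x) X"
      by (rule ell2_has_sum_pointwise[OF bounded_op_basis_expansion[OF R True]])
        (intro ell2_scale bounded_op_mem[OF R] ell2_basis_mem)
    moreover have "((\<lambda>v. f v * S (ell2_basis v) x) has_sum y) X \<longleftrightarrow>
        ((\<lambda>v. f v * R (ell2_basis v) x) has_sum y) X" for y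
      by (rule has_sum_cong) (simp add: eq)
    ultimately show ?thesis using has_sum_unique by blast
  qed (use S R in \<open>auto simp: bounded_op_def\<close>)
qed

lemma ell2_inner_linear_left:
  assumes "f \<in> ell2 X" "g \<in> ell2 X" "h \<in> ell2 X"
  shows "ell2_inner X (\<lambda>x. f x + g x) h = ell2_inner X f h + ell2_inner X g h"
    "ell2_inner X (\<lambda>x. c * f x) h = c * ell2_inner X f h"
proof -
  show "ell2_inner X (\<lambda>x. f x + g x) h = ell2_inner X f h + ell2_inner X g h"
    using has_sum_unique[OF has_sum_add[OF ell2_inner_has_sum[OF assms(1,3)] ell2_inner_has_sum[OF assms(2,3)]]]
      ell2_inner_has_sum[OF ell2_add[OF assms(1,2)] assms(3)]
    by (simp add: distrib_right)
  show "ell2_inner X (\<lambda>x. c * f x) h = c * ell2_inner X f h"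
    using has_sum_unique[OF has_sum_cmult_right[OF ell2_inner_has_sum[OF assms(1,3)], of c]]
      ell2_inner_has_sum[OF ell2_scale[OF assms(1), of c] assms(3)]
    by (simp add: mult.assoc)
qed

lemma ell2_inner_diff_left:
  assumes "f \<in> ell2 X" "g \<in> ell2 X" "h \<in> ell2 X"
  shows "ell2_inner X (\<lambda>x. f x - g x) h = ell2_inner X f h - ell2_inner X g h"
  using ell2_inner_linear_left(1)[OF assms(1) ell2_scale[OF assms(2), of "-1"] assms(3)]
    ell2_inner_linear_left(2)[OF assms(2,2,3), of "-1"] by simp

lemma ell2_inner_sum_left:
  assumes "finite F" "\<And>i. i \<in> F \<Longrightarrow> g i \<in> ell2 X" "h \<in> ell2 X"
  shows "ell2_inner X (\<lambda>x. \<Sum>i\<in>F. g i x) h = (\<Sum>i\<in>F. ell2_inner X (g i) h)"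
  using assms
proof (induction F rule: finite_induct)
  case empty
  then show ?case by (simp add: ell2_inner_def)
next
  case (insert a F)
  then show ?case
    using ell2_inner_linear_left(1)[of "g a" X "\<lambda>x. \<Sum>i\<in>F. g i x" h] ell2_sum[of F g X] by auto
qed

lemma ell2_inner_has_sum_left:
  assumes g: "ell2_has_sum X g f I" "\<And>i. i \<in> I \<Longrightarrow> g i \<in> ell2 X" and h: "h \<in> ell2 X"
  shows "((\<lambda>i. ell2_inner X (g i) h) has_sum ell2_inner X f h) I"
proof -
  have f: "f \<in> ell2 X" and lim:
    "((\<lambda>F. ell2_norm X (\<lambda>x. f x - (\<Sum>i\<in>F. g i x))) \<longlongrightarrow> 0) (finite_subsets_at_top I)"
    using assms(1) by (auto simp: ell2_has_sum_def)
  have "((\<lambda>F. ell2_inner X f h - (\<Sum>i\<in>F. ell2_inner X (g i) h)) \<longlongrightarrow> 0) (finite_subsets_at_top I)"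
  proof (rule Lim_null_comparison[OF _ tendsto_mult_left_zero[OF lim, of "ell2_norm X h"]],
      rule eventually_finite_subsets_at_top_weakI)
    fix F assume F: "finite F" "F \<subseteq> I"
    then have s: "(\<lambda>x. \<Sum>i\<in>F. g i x) \<in> ell2 X" using g(2) by (intro ell2_sum) auto
    have "ell2_inner X f h - (\<Sum>i\<in>F. ell2_inner X (g i) h)
        = ell2_inner X (\<lambda>x. f x - (\<Sum>i\<in>F. g i x)) h"
      using F g(2) by (subst ell2_inner_diff_left[OF f s h], subst ell2_inner_sum_left) (auto simp: h)
    then show "norm (ell2_inner X f h - (\<Sum>i\<in>F. ell2_inner X (g i) h))
        \<le> ell2_norm X (\<lambda>x. f x - (\<Sum>i\<in>F. g i x)) * ell2_norm X h"
      using ell2_Cauchy_Schwarz[OF ell2_diff[OF f s] h] by simp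
  qed
  from tendsto_diff[OF tendsto_const[of "ell2_inner X f h"] this]
  show ?thesis by (simp add: has_sum_def)
qed

lemma ell2_inner_cnj: "ell2_inner X f g = cnj (ell2_inner X g f)"
  unfolding ell2_inner_def by (simp flip: infsum_cnj add: mult.commute)

theorem op_adjoint_ex1:
  assumes S: "bounded_op X S"
  shows "\<exists>!R. bounded_op X R \<and>
    (\<forall>f\<in>ell2 X. \<forall>g\<in>ell2 X. ell2_inner X (S f) g = ell2_inner X f (R g))"
proof (rule ex_ex1I)
  obtain C where C: "C \<ge> 0" "\<And>f. f \<in> ell2 X \<Longrightarrow> ell2_norm X (S f) \<le> C * ell2_norm X f"
    using bounded_op_bound[OF S] by blast
  define R where "R g = (\<lambda>u. if g \<in> ell2 X \<and> u \<in> X then ell2_inner X g (S (ell2_basis u)) else 0)"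
    for g :: "'a \<Rightarrow> complex"
  have Rcnj: "R g u = cnj (ell2_inner X (S (ell2_basis u)) g)" if "g \<in> ell2 X" "u \<in> X" for g u
    using that by (simp add: R_def ell2_inner_cnj[of X g])
  have part: "(\<Sum>u\<in>F. (cmod (R g u))\<^sup>2) \<le> (C * ell2_norm X g)\<^sup>2"
    if g: "g \<in> ell2 X" and F: "finite F" "F \<subseteq> X" for g F
  proof -
    define s where "s = (\<Sum>u\<in>F. (cmod (R g u))\<^sup>2)"
    define h where "h = (\<lambda>x. \<Sum>u\<in>F. R g u * ell2_basis u x)"
    have mem: "(\<lambda>x. R g u * ell2_basis u x) \<in> ell2 X" if "u \<in> F" for u
      using that F by (intro ell2_scale ell2_basis_mem) auto
    have h: "h \<in> ell2 X" unfolding h_def by (rule ell2_sum[OF F(1) mem])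
    have hv: "h x = (if x \<in> F then R g x else 0)" for x
      using F(1) by (simp add: h_def ell2_basis_def if_distrib[of "\<lambda>y. _ * y"] cong: if_cong)
    have "(\<Sum>\<^sub>\<infinity>x\<in>X. (cmod (h x))\<^sup>2) = (\<Sum>\<^sub>\<infinity>x\<in>F. (cmod (R g x))\<^sup>2)"
      by (rule infsum_cong_neutral) (use F in \<open>auto simp: hv\<close>)
    then have nh: "ell2_norm X h = sqrt s" using F by (simp add: ell2_norm_def s_def)
    have sc: "S (\<lambda>x. R g u * ell2_basis u x) = (\<lambda>x. R g u * S (ell2_basis u) x)" if "u \<in> F" for u
      using that F by (intro bounded_op_scale[OF S] ell2_basis_mem) auto
    have "S h = (\<lambda>x. \<Sum>u\<in>F. S (\<lambda>x. R g u * ell2_basis u x) x)"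
      unfolding h_def by (rule bounded_op_sum[OF S F(1) mem])
    also have "\<dots> = (\<lambda>x. \<Sum>u\<in>F. R g u * S (ell2_basis u) x)"
      using sc by (intro ext sum.cong) auto
    finally have Sh: "S h = (\<lambda>x. \<Sum>u\<in>F. R g u * S (ell2_basis u) x)" .
    have "ell2_inner X (S h) g = (\<Sum>u\<in>F. ell2_inner X (\<lambda>x. R g u * S (ell2_basis u) x) g)"
      unfolding Sh using F
      by (intro ell2_inner_sum_left ell2_scale bounded_op_mem[OF S] ell2_basis_mem g) auto
    also have "\<dots> = (\<Sum>u\<in>F. R g u * cnj (R g u))"
    proof (rule sum.cong)
      fix u assume "u \<in> F"
      then have u: "u \<in> X" using F by auto
      then have "S (ell2_basis u) \<in> ell2 X" by (intro bounded_op_mem[OF S] ell2_basis_mem)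
      then show "ell2_inner X (\<lambda>x. R g u * S (ell2_basis u) x) g = R g u * cnj (R g u)"
        using ell2_inner_linear_left(2)[of "S (ell2_basis u)" X "S (ell2_basis u)" g] g u
        by (simp add: Rcnj)
    qed simp
    also have "\<dots> = of_real s"
      unfolding s_def of_real_sum by (rule sum.cong) (simp_all only: complex_norm_square)
    finally have "s \<le> cmod (ell2_inner X (S h) g)"
      by (simp del: of_real_sum)
    also have "\<dots> \<le> ell2_norm X (S h) * ell2_norm X g"
      by (rule ell2_Cauchy_Schwarz[OF bounded_op_mem[OF S h] g])
    also have "\<dots> \<le> C * sqrt s * ell2_norm X g"
      using C(2)[OF h] nh ell2_norm_nonneg by (metis mult_right_mono)
    finally have *: "s \<le> sqrt s * (C * ell2_norm X g)" by (simp add: mult_ac)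
    have s0: "s \<ge> 0" unfolding s_def by (simp add: sum_nonneg)
    have "sqrt s \<le> C * ell2_norm X g"
    proof (cases "s = 0")
      case True then show ?thesis using C(1) ell2_norm_nonneg[of X g] by simp
    next
      case False
      then have "sqrt s > 0" using s0 by simp
      moreover have "sqrt s * sqrt s \<le> sqrt s * (C * ell2_norm X g)" using * s0 by simp
      ultimately show ?thesis using mult_le_cancel_left_pos by blast
    qed
    then show ?thesis using s0 s_def by (metis power_mono real_sqrt_ge_zero real_sqrt_pow2)
  qed
  have Rmem: "R g \<in> ell2 X" if "g \<in> ell2 X" for g
    by (rule ell2I[OF _ part[OF that]]) (auto simp: R_def)
  have Rnorm: "ell2_norm X (R g) \<le> C * ell2_norm X g" if "g \<in> ell2 X" for g
    by (rule ell2_norm_le[OF part[OF that] _ Rmem[OF that]]) (simp_all add: C(1) ell2_norm_nonneg)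
  have bR: "bounded_op X R"
    unfolding bounded_op_def
  proof (intro conjI ballI allI impI)
    fix f g assume f: "f \<in> ell2 X" and g: "g \<in> ell2 X"
    show "R (\<lambda>x. f x + g x) = (\<lambda>x. R f x + R g x)"
    proof
      fix u show "R (\<lambda>x. f x + g x) u = R f u + R g u"
        using ell2_inner_linear_left(1)[OF f g bounded_op_mem[OF S ell2_basis_mem[of u X]]]
        by (simp add: R_def f g ell2_add)
    qed
  next
    fix c f assume f: "f \<in> ell2 X"
    show "R (\<lambda>x. c * f x) = (\<lambda>x. c * R f x)"
    proof
      fix u show "R (\<lambda>x. c * f x) u = c * R f u"
        using ell2_inner_linear_left(2)[OF f f bounded_op_mem[OF S ell2_basis_mem[of u X]]]
        by (simp add: R_def f ell2_scale)
    qed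
  qed (use Rmem Rnorm in \<open>auto simp: R_def\<close>)
  have "ell2_inner X (S f) g = ell2_inner X f (R g)" if f: "f \<in> ell2 X" and g: "g \<in> ell2 X" for f g
  proof -
    have Sb: "S (ell2_basis v) \<in> ell2 X" if "v \<in> X" for v
      using that by (intro bounded_op_mem[OF S] ell2_basis_mem)
    have "((\<lambda>v. ell2_inner X (\<lambda>x. f v * S (ell2_basis v) x) g) has_sum ell2_inner X (S f) g) X"
      by (rule ell2_inner_has_sum_left[OF bounded_op_basis_expansion[OF S f] _ g])
        (intro ell2_scale Sb)
    also have "?this \<longleftrightarrow> ((\<lambda>v. f v * cnj (R g v)) has_sum ell2_inner X (S f) g) X"
      by (rule has_sum_cong)
        (use ell2_inner_linear_left(2)[OF Sb Sb g] in \<open>simp add: Rcnj[OF g]\<close>)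
    finally show ?thesis
      using has_sum_unique ell2_inner_has_sum[OF f Rmem[OF g]] by blast
  qed
  with bR show "\<exists>R. bounded_op X R \<and>
      (\<forall>f\<in>ell2 X. \<forall>g\<in>ell2 X. ell2_inner X (S f) g = ell2_inner X f (R g))" by blast
next
  fix R R' assume R: "bounded_op X R \<and>
      (\<forall>f\<in>ell2 X. \<forall>g\<in>ell2 X. ell2_inner X (S f) g = ell2_inner X f (R g))"
    and R': "bounded_op X R' \<and>
      (\<forall>f\<in>ell2 X. \<forall>g\<in>ell2 X. ell2_inner X (S f) g = ell2_inner X f (R' g))"
  have "R g u = R' g u" if g: "g \<in> ell2 X" for g u
  proof (cases "u \<in> X")
    case True
    have "ell2_inner X (ell2_basis u) (R g) = ell2_inner X (ell2_basis u) (R' g)"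
      using R R' g ell2_basis_mem[OF True] by metis
    then show ?thesis
      using ell2_inner_basis(2) True R R' g bounded_op_mem by (metis complex_cnj_cancel_iff)
  next
    case False
    then show ?thesis using R R' g unfolding bounded_op_def ell2_def by auto
  qed
  then show "R = R'"
    using R R' by (intro bounded_op_eqI[of X]) (auto intro!: ext ell2_basis_mem)
qed

lemma op_adjoint:
  assumes "bounded_op X S"
  shows "bounded_op X (op_adjoint X S)"
    and "f \<in> ell2 X \<Longrightarrow> g \<in> ell2 X \<Longrightarrow> ell2_inner X (S f) g = ell2_inner X f (op_adjoint X S g)"
  using theI'[OF op_adjoint_ex1[OF assms], folded op_adjoint_def] by auto

theorem weighted_shift_ex1:
  assumes M: "discrete_measure_space M" and T: "T \<in> space M \<rightarrow> space M"
    and h: "h_fun M T \<in> Linfty M"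
  defines "shift \<equiv> \<lambda>f v. if f \<in> ell2 (space M) \<and> v \<in> space M
      then complex_of_real (weight M T v) * f (T v) else 0"
  defines "P \<equiv> \<lambda>S. bounded_op (space M) S \<and>
     (\<forall>u\<in>space M. ell2_has_sum (space M)
        (\<lambda>v x. complex_of_real (weight M T v) * ell2_basis v x)
        (S (ell2_basis u)) {v \<in> space M. T v = u})"
  shows "\<exists>!S. P S" and "weighted_shift M T = shift"
proof -
  let ?X = "space M"
  have sets: "sets M = Pow ?X" and pos: "\<And>x. x \<in> ?X \<Longrightarrow> 0 < emeasure M {x}"
    and fin: "\<And>x. x \<in> ?X \<Longrightarrow> emeasure M {x} < \<infinity>"
    using M by (auto simp: discrete_measure_space_def)
  have em: "emeasure M {x} = ennreal (measure M {x})" if "x \<in> ?X" for x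
    using fin[OF that] by (simp add: emeasure_eq_ennreal_measure)
  have mpos: "measure M {x} > 0" if "x \<in> ?X" for x
    using pos[OF that] em[OF that] by simp
  have Tx: "T x \<in> ?X" if "x \<in> ?X" for x using T that by auto
  obtain C0 where C0: "AE x in M. h_fun M T x \<le> ennreal C0" using h by (auto simp: Linfty_def)
  define C where "C = max C0 0"
  have hC: "h_fun M T x \<le> ennreal C" if x: "x \<in> ?X" for x
  proof -
    obtain N where N: "N \<in> null_sets M" "{x \<in> ?X. \<not> h_fun M T x \<le> ennreal C0} \<subseteq> N"
      using C0 by (rule AE_E3) (auto simp: null_sets_def)
    have "x \<notin> N"
    proof
      assume "x \<in> N"
      then have "emeasure M {x} \<le> emeasure M N" using N(1) by (intro emeasure_mono) auto
      then show False using N(1) pos[OF x] by (auto simp: null_sets_def)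
    qed
    then have "h_fun M T x \<le> ennreal C0" using N(2) x by auto
    also have "\<dots> \<le> ennreal C" by (rule ennreal_leI) (simp add: C_def)
    finally show ?thesis .
  qed
  have fibre: "(\<Sum>v\<in>F. measure M {v}) \<le> C * measure M {u}"
    if u: "u \<in> ?X" and F: "finite F" "F \<subseteq> {v \<in> ?X. T v = u}" for u F
  proof -
    have "ennreal (\<Sum>v\<in>F. measure M {v}) = (\<Sum>v\<in>F. emeasure M {v})"
      using F em by (subst sum_ennreal[symmetric]) (auto intro!: sum.cong simp: subset_iff)
    also have "\<dots> = emeasure M F"
      using F sets by (intro emeasure_eq_sum_singleton[symmetric]) auto
    also have "\<dots> \<le> emeasure M (T -` {u} \<inter> ?X)"
      using F sets by (intro emeasure_mono) auto
    also have "\<dots> = h_fun M T u * emeasure M {u}"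
      unfolding h_fun_def using pos[OF u] fin[OF u]
      by (simp add: ennreal_divide_times ennreal_divide_self ennreal_mult_divide_eq flip: ennreal_times_divide)
    also have "\<dots> \<le> ennreal C * ennreal (measure M {u})"
      unfolding em[OF u] using hC[OF u] by (intro mult_right_mono) auto
    also have "\<dots> = ennreal (C * measure M {u})"
      by (simp add: ennreal_mult C_def)
    finally show ?thesis by (simp add: C_def)
  qed
  have wsq: "(cmod (complex_of_real (weight M T v) * z))\<^sup>2 = measure M {v} / measure M {T v} * (cmod z)\<^sup>2"
    for v z
    by (simp add: weight_def norm_mult norm_divide power_mult_distrib power_divide)
  have part: "(\<Sum>v\<in>F. (cmod (shift f v))\<^sup>2) \<le> (sqrt C * ell2_norm ?X f)\<^sup>2"
    if f: "f \<in> ell2 ?X" and F: "finite F" "F \<subseteq> ?X" for f F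
  proof -
    have "(\<Sum>v\<in>F. (cmod (shift f v))\<^sup>2)
        = (\<Sum>v\<in>F. measure M {v} / measure M {T v} * (cmod (f (T v)))\<^sup>2)"
      using F f by (intro sum.cong) (auto simp: shift_def wsq)
    also have "\<dots> = (\<Sum>u\<in>T ` F. \<Sum>v\<in>{v\<in>F. T v = u}. measure M {v} / measure M {T v} * (cmod (f (T v)))\<^sup>2)"
      by (rule sum.image_gen[OF F(1)])
    also have "\<dots> = (\<Sum>u\<in>T ` F. (\<Sum>v\<in>{v\<in>F. T v = u}. measure M {v}) / measure M {u} * (cmod (f u))\<^sup>2)"
      by (intro sum.cong refl) (simp add: sum_distrib_right sum_divide_distrib)
    also have "\<dots> \<le> (\<Sum>u\<in>T ` F. C * (cmod (f u))\<^sup>2)"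
    proof (intro sum_mono mult_right_mono)
      fix u assume "u \<in> T ` F"
      then have u: "u \<in> ?X" using Tx F by auto
      show "(\<Sum>v\<in>{v\<in>F. T v = u}. measure M {v}) / measure M {u} \<le> C"
        using fibre[OF u, of "{v\<in>F. T v = u}"] F mpos[OF u] by (auto simp: divide_le_eq)
    qed simp
    also have "\<dots> = C * (\<Sum>u\<in>T ` F. (cmod (f u))\<^sup>2)" by (simp add: sum_distrib_left)
    also have "\<dots> \<le> C * (ell2_norm ?X f)\<^sup>2"
      using F Tx by (intro mult_left_mono ell2_norm_sum_le f) (auto simp: C_def)
    finally show ?thesis by (simp add: power_mult_distrib C_def)
  qed
  have mem: "shift f \<in> ell2 ?X" if "f \<in> ell2 ?X" for f
    by (rule ell2I[OF _ part[OF that]]) (auto simp: shift_def)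
  have nrm: "ell2_norm ?X (shift f) \<le> sqrt C * ell2_norm ?X f" if "f \<in> ell2 ?X" for f
    by (rule ell2_norm_le[OF part[OF that] _ mem[OF that]]) (simp_all add: C_def ell2_norm_nonneg)
  have bS: "bounded_op ?X shift"
    unfolding bounded_op_def
  proof (intro conjI ballI allI impI)
    show "\<exists>C. \<forall>f\<in>ell2 ?X. ell2_norm ?X (shift f) \<le> C * ell2_norm ?X f" using nrm by blast
  next
    fix f g assume "f \<in> ell2 ?X" "g \<in> ell2 ?X"
    then show "shift (\<lambda>x. f x + g x) = (\<lambda>x. shift f x + shift g x)"
      by (intro ext) (simp add: shift_def ell2_add distrib_left)
  next
    fix c f assume "f \<in> ell2 ?X"
    then show "shift (\<lambda>x. c * f x) = (\<lambda>x. c * shift f x)"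
      by (intro ext) (simp add: shift_def ell2_scale)
  next
    fix f assume "f \<notin> ell2 ?X"
    then show "shift f = (\<lambda>x. 0)" by (simp add: shift_def)
  qed (rule mem)
  have wmem: "(\<lambda>x. complex_of_real (weight M T v) * ell2_basis v x) \<in> ell2 ?X" if "v \<in> ?X" for v
    by (intro ell2_scale ell2_basis_mem that)
  have on_basis: "ell2_has_sum ?X (\<lambda>v x. complex_of_real (weight M T v) * ell2_basis v x)
      (shift (ell2_basis u)) {v \<in> ?X. T v = u}" if u: "u \<in> ?X" for u
  proof -
    let ?g = "shift (ell2_basis u)" and ?A = "{v \<in> ?X. T v = u}"
    have g: "?g \<in> ell2 ?X" by (rule mem[OF ell2_basis_mem[OF u]])
    have gv: "?g v = (if v \<in> ?A then complex_of_real (weight M T v) else 0)" for v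
      using ell2_basis_mem[OF u] by (simp add: shift_def ell2_basis_def)
    have sums: "(\<Sum>v\<in>F. ?g v * ell2_basis v x)
        = (\<Sum>v\<in>F \<inter> ?A. complex_of_real (weight M T v) * ell2_basis v x)" if "finite F" for F x
      using that by (intro sum.mono_neutral_cong_right) (auto simp: gv)
    have lim: "((\<lambda>F. ell2_norm ?X (\<lambda>x. ?g x - (\<Sum>v\<in>F. ?g v * ell2_basis v x))) \<longlongrightarrow> 0)
        (finite_subsets_at_top ?X)"
      using ell2_basis_expansion[OF g] by (simp add: ell2_has_sum_def)
    have "((\<lambda>F. ell2_norm ?X (\<lambda>x. ?g x - (\<Sum>v\<in>F. complex_of_real (weight M T v) * ell2_basis v x)))
        \<longlongrightarrow> 0) (finite_subsets_at_top ?A)"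
    proof (rule tendstoI)
      fix e :: real assume "e > 0"
      from tendstoD[OF lim this, unfolded eventually_finite_subsets_at_top]
      obtain F0 where F0: "finite F0" "F0 \<subseteq> ?X"
        and F0': "\<forall>F. finite F \<and> F0 \<subseteq> F \<and> F \<subseteq> ?X \<longrightarrow>
          dist (ell2_norm ?X (\<lambda>x. ?g x - (\<Sum>v\<in>F. ?g v * ell2_basis v x))) 0 < e"
        by (elim exE conjE)
      show "\<forall>\<^sub>F F in finite_subsets_at_top ?A. dist (ell2_norm ?X
          (\<lambda>x. ?g x - (\<Sum>v\<in>F. complex_of_real (weight M T v) * ell2_basis v x))) 0 < e"
        unfolding eventually_finite_subsets_at_top
      proof (intro exI[of _ "F0 \<inter> ?A"] conjI allI impI)
        fix F assume F: "finite F \<and> F0 \<inter> ?A \<subseteq> F \<and> F \<subseteq> ?A"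
        then have eq: "(F \<union> F0) \<inter> ?A = F" by auto
        have "dist (ell2_norm ?X (\<lambda>x. ?g x - (\<Sum>v\<in>F \<union> F0. ?g v * ell2_basis v x))) 0 < e"
          using F F0 by (intro F0'[rule_format]) auto
        then show "dist (ell2_norm ?X
            (\<lambda>x. ?g x - (\<Sum>v\<in>F. complex_of_real (weight M T v) * ell2_basis v x))) 0 < e"
          using F F0 by (simp only: sums finite_UnI eq)
      qed (use F0 in auto)
    qed
    then show ?thesis using g by (simp add: ell2_has_sum_def)
  qed
  have PS: "P shift" using bS on_basis by (simp add: P_def)
  have unique: "S = shift" if "P S" for S
  proof (rule bounded_op_eqI[of ?X])
    fix u assume u: "u \<in> ?X"
    show "S (ell2_basis u) = shift (ell2_basis u)"
    proof
      fix x
      have "((\<lambda>v. complex_of_real (weight M T v) * ell2_basis v x) has_sum S (ell2_basis u) x)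
          {v \<in> ?X. T v = u}"
        using that u by (intro ell2_has_sum_pointwise[of ?X] wmem) (auto simp: P_def)
      moreover have "((\<lambda>v. complex_of_real (weight M T v) * ell2_basis v x) has_sum
          shift (ell2_basis u) x) {v \<in> ?X. T v = u}"
        using on_basis[OF u] by (intro ell2_has_sum_pointwise[of ?X] wmem) auto
      ultimately show "S (ell2_basis u) x = shift (ell2_basis u) x" by (rule has_sum_unique)
    qed
  qed (use that bS in \<open>auto simp: P_def\<close>)
  show "\<exists>!S. P S" using PS unique by blast
  show "weighted_shift M T = shift"
    unfolding weighted_shift_def using PS unique unfolding P_def by (rule the_equality)
qed

end

theory Submission
  imports Defs
begin

text \<open>
  Let \<open>N k u\<close> be the mass of the fibre of \<open>T\<^sup>k\<close> over \<open>u\<close>. The operator \<open>S\<^sup>*\<^sup>kS\<^sup>k\<close> is multiplication by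
  \<open>N k u / N 0 u\<close>, so both conditions are statements about the sequences \<open>k \<mapsto> N k u\<close>: being
  2-isometric means that they are all affine, and nonnegativity then forces them to be
  nondecreasing, whence complete hyperexpansivity. Conversely, complete hyperexpansivity makes
  them nondecreasing and concave. If \<open>T\<^sup>K w = w\<close>, then \<open>N (k + K) w - N k w\<close> is the sum of \<open>N k x\<close>
  over \<open>x \<noteq> w\<close> with \<open>T\<^sup>K x = w\<close>; it is nonincreasing in \<open>k\<close> by concavity at \<open>w\<close>, and nondecreasing
  by monotonicity at the points \<open>x\<close>. Hence it is constant, which makes \<open>N k x\<close> constant for each
  such \<open>x\<close> and \<open>N k w\<close> affine. As the graph is connected and contains a cycle, every vertex is
  such a \<open>w\<close> or such an \<open>x\<close>.
\<close>

section \<open>Infinite sums of real-valued families\<close>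

lemma summable_on_diff:
  fixes f g :: "'a \<Rightarrow> real"
  assumes "f summable_on A" "g summable_on A"
  shows "(\<lambda>x. f x - g x) summable_on A"
  using summable_on_add[OF assms(1) summable_on_uminus[THEN iffD2, OF assms(2)]] by simp

lemma infsum_diff:
  fixes f g :: "'a \<Rightarrow> real"
  assumes "f summable_on A" "g summable_on A"
  shows "(\<Sum>\<^sub>\<infinity>x\<in>A. f x - g x) = infsum f A - infsum g A"
  using infsum_add[OF assms(1) summable_on_uminus[THEN iffD2, OF assms(2)]] by (simp add: infsum_uminus)

text \<open>\<open>Re\<close> is a bounded left inverse of the embedding, so both sides are summable
  together; otherwise both take the default value 0.\<close>

lemma infsum_complex_of_real:
  "(\<Sum>\<^sub>\<infinity>x\<in>A. complex_of_real (f x)) = complex_of_real (infsum f A)"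
  by (rule infsum_bounded_linear_strong[OF summable_on_bounded_linear_iff])
    (auto intro: bounded_linear_of_real bounded_linear_Re)

text \<open>Separates the shift from measure theory: point masses become a real function
  \<open>m\<close>, and the bound on \<open>h_fun\<close> survives as boundedness of
  \<open>S\<close>.\<close>

locale weighted_self_map =
  fixes X :: "'a set" and T :: "'a \<Rightarrow> 'a" and m :: "'a \<Rightarrow> real"
    and S :: "('a \<Rightarrow> complex) \<Rightarrow> 'a \<Rightarrow> complex"
  assumes maps: "T \<in> X \<rightarrow> X"
    and pos: "\<And>x. x \<in> X \<Longrightarrow> 0 < m x"
    and bounded: "bounded_op X S"
    and S_eq: "\<And>f v. f \<in> ell2 X \<Longrightarrow> v \<in> X \<Longrightarrow>
      S f v = complex_of_real (sqrt (m v) / sqrt (m (T v))) * f (T v)"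
begin

section \<open>Masses of the fibres of the iterates\<close>

definition fibre :: "nat \<Rightarrow> 'a \<Rightarrow> 'a set" where
  "fibre k u = {v \<in> X. (T ^^ k) v = u}"

text \<open>This is \<open>N k u\<close> of the overview. A divergent sum would give the default 0;
  \<open>summable_fibre\<close> excludes this for \<open>u\<close> in \<open>X\<close>.\<close>

definition mass :: "nat \<Rightarrow> 'a \<Rightarrow> real" where
  "mass k u = (\<Sum>\<^sub>\<infinity>v\<in>fibre k u. m v)"

lemma funpow_mem: "x \<in> X \<Longrightarrow> (T ^^ k) x \<in> X"
  using maps by (induction k) auto

lemma fibre_0: "u \<in> X \<Longrightarrow> fibre 0 u = {u}"
  by (auto simp: fibre_def)

lemma mass_0: "u \<in> X \<Longrightarrow> mass 0 u = m u"
  by (simp add: mass_def fibre_0)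

lemma mass_nonneg: "0 \<le> mass k u"
  unfolding mass_def by (rule infsum_nonneg) (use pos in \<open>auto simp: fibre_def less_imp_le\<close>)

lemma funpow_shift_mem: "f \<in> ell2 X \<Longrightarrow> (S ^^ k) f \<in> ell2 X"
  by (induction k) (auto intro: bounded_op_mem[OF bounded])

lemma funpow_shift:
  assumes "f \<in> ell2 X" "v \<in> X"
  shows "(S ^^ k) f v = complex_of_real (sqrt (m v) / sqrt (m ((T ^^ k) v))) * f ((T ^^ k) v)"
  using assms(2)
proof (induction k arbitrary: v)
  case 0
  then show ?case using pos[of v] by simp
next
  case (Suc k)
  have Tv: "T v \<in> X" using Suc.prems maps by auto
  have "(S ^^ Suc k) f v = complex_of_real (sqrt (m v) / sqrt (m (T v))) * (S ^^ k) f (T v)"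
    using S_eq[OF funpow_shift_mem[OF assms(1)] Suc.prems] by simp
  then show ?case
    using Suc.IH[OF Tv] pos[OF Tv] by (simp add: funpow_swap1)
qed

text \<open>\<open>S^k e_u\<close> is square summable, and its squared modulus at a point
  \<open>v\<close> of the fibre is \<open>m v / m u\<close>.\<close>

lemma summable_fibre:
  assumes u: "u \<in> X"
  shows "m summable_on fibre k u"
proof -
  have "(S ^^ k) (ell2_basis u) \<in> ell2 X" by (rule funpow_shift_mem[OF ell2_basis_mem[OF u]])
  then have "(\<lambda>v. (cmod ((S ^^ k) (ell2_basis u) v))\<^sup>2) summable_on fibre k u"
    by (auto simp: ell2_def fibre_def intro: summable_on_subset_banach)
  also have "?this \<longleftrightarrow> (\<lambda>v. m v / m u) summable_on fibre k u"
  proof (rule summable_on_cong)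
    fix v assume "v \<in> fibre k u"
    then have v: "v \<in> X" "(T ^^ k) v = u" by (auto simp: fibre_def)
    show "(cmod ((S ^^ k) (ell2_basis u) v))\<^sup>2 = m v / m u"
      using funpow_shift[OF ell2_basis_mem[OF u] v(1)] v pos[OF v(1)] pos[OF u]
      by (simp add: ell2_basis_def norm_mult norm_divide power_divide)
  qed
  finally have "(\<lambda>v. m u * (m v / m u)) summable_on fibre k u"
    by (rule summable_on_cmult_right)
  then show ?thesis using pos[OF u] by simp
qed

text \<open>The fibre of \<open>T^(k+j)\<close> over \<open>u\<close> is the disjoint union of the
  fibres of \<open>T^k\<close> over the points of \<open>fibre j u\<close>, and \<open>m\<close> is
  summed over it in two stages. \<open>snd\<close> is injective on the Sigma set because
  \<open>x\<close> determines its base point \<open>T^k x\<close>.\<close>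

lemma
  assumes u: "u \<in> X"
  shows summable_mass: "mass k summable_on fibre j u"
    and mass_add: "mass (k + j) u = (\<Sum>\<^sub>\<infinity>v\<in>fibre j u. mass k v)"
proof -
  let ?\<Sigma> = "Sigma (fibre j u) (fibre k)"
  have eq: "fibre (k + j) u = snd ` ?\<Sigma>"
    using funpow_mem by (force simp: fibre_def funpow_add add.commute[of k])
  have inj: "inj_on snd ?\<Sigma>" by (auto simp: inj_on_def fibre_def)
  have s: "(\<lambda>(v, x). m x) summable_on ?\<Sigma>"
    using summable_fibre[OF u, of "k + j"]
    unfolding eq summable_on_reindex[OF inj] by (simp add: o_def case_prod_unfold)
  show "mass k summable_on fibre j u"
    using summable_on_Sigma_banach[OF s] by (simp add: mass_def[abs_def])
  show "mass (k + j) u = (\<Sum>\<^sub>\<infinity>v\<in>fibre j u. mass k v)"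
    using infsum_Sigma'_banach[OF s] unfolding mass_def eq infsum_reindex[OF inj]
    by (simp add: o_def case_prod_unfold)
qed

section \<open>Diagonal form of \<open>S*^k S^k\<close>\<close>

lemma funpow_adjoint_mem: "f \<in> ell2 X \<Longrightarrow> (op_adjoint X S ^^ k) f \<in> ell2 X"
  by (induction k) (auto intro: bounded_op_mem[OF op_adjoint(1)[OF bounded]])

lemma inner_funpow_adjoint:
  assumes "f \<in> ell2 X" "g \<in> ell2 X"
  shows "ell2_inner X ((S ^^ k) f) g = ell2_inner X f ((op_adjoint X S ^^ k) g)"
  using assms(2)
proof (induction k arbitrary: g)
  case (Suc k)
  show ?case
    using Suc.IH[OF bounded_op_mem[OF op_adjoint(1)[OF bounded] Suc.prems]]
      op_adjoint(2)[OF bounded funpow_shift_mem[OF assms(1)] Suc.prems]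
    by (simp add: funpow_swap1)
qed simp

text \<open>The coordinate at \<open>u\<close> is the inner product of \<open>S^k f\<close> with
  \<open>S^k e_u\<close>. The latter lives on \<open>fibre k u\<close>, where \<open>S^k f\<close>
  sees only the value \<open>f u\<close> and the two square-root weights multiply to
  \<open>m v / m u\<close>.\<close>

lemma adjoint_shift_diagonal:
  assumes f: "f \<in> ell2 X"
  shows "(op_adjoint X S ^^ k) ((S ^^ k) f) = (\<lambda>u. complex_of_real (mass k u / m u) * f u)"
proof
  fix u
  let ?g = "(S ^^ k) f"
  have g: "?g \<in> ell2 X" by (rule funpow_shift_mem[OF f])
  note Rg = funpow_adjoint_mem[OF g, of k]
  show "(op_adjoint X S ^^ k) ?g u = complex_of_real (mass k u / m u) * f u"
  proof (cases "u \<in> X")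
    case False
    then show ?thesis using f Rg by (simp add: ell2_def)
  next
    case u: True
    note e = ell2_basis_mem[OF u]
    have "cnj ((op_adjoint X S ^^ k) ?g u) = ell2_inner X ((S ^^ k) (ell2_basis u)) ?g"
      using ell2_inner_basis(2)[OF Rg u] inner_funpow_adjoint[OF e g] by simp
    then have "(op_adjoint X S ^^ k) ?g u = ell2_inner X ?g ((S ^^ k) (ell2_basis u))"
      by (metis ell2_inner_cnj complex_cnj_cnj)
    also have "\<dots> = (\<Sum>\<^sub>\<infinity>v\<in>fibre k u. (f u / complex_of_real (m u)) * complex_of_real (m v))"
      unfolding ell2_inner_def
    proof (rule infsum_cong_neutral)
      fix v assume "v \<in> X \<inter> fibre k u"
      then have v: "v \<in> X" "(T ^^ k) v = u" by (auto simp: fibre_def)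
      have "complex_of_real (sqrt (m v)) * complex_of_real (sqrt (m v)) = complex_of_real (m v)"
        "complex_of_real (sqrt (m u)) * complex_of_real (sqrt (m u)) = complex_of_real (m u)"
        using pos[OF u] pos[OF v(1)] by (simp_all flip: of_real_mult)
      then show "?g v * cnj ((S ^^ k) (ell2_basis u) v)
          = f u / complex_of_real (m u) * complex_of_real (m v)"
        unfolding funpow_shift[OF f v(1)] funpow_shift[OF e v(1)] v(2)
        by (simp add: ell2_basis_def)
    next
      fix v assume "v \<in> X - fibre k u"
      then show "?g v * cnj ((S ^^ k) (ell2_basis u) v) = 0"
        using funpow_shift[OF e, of v] by (auto simp: ell2_basis_def fibre_def)
    qed (auto simp: fibre_def)
    also have "\<dots> = f u / complex_of_real (m u) * complex_of_real (mass k u)"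
      by (simp only: infsum_cmult_right' infsum_complex_of_real mass_def)
    finally show ?thesis by simp
  qed
qed

section \<open>Both operator conditions in terms of masses\<close>

lemma two_isometric_iff:
  "two_isometric X S \<longleftrightarrow> (\<forall>u\<in>X. m u - 2 * mass 1 u + mass 2 u = 0)"
proof -
  have eq: "f u - 2 * op_adjoint X S (S f) u + (op_adjoint X S ^^ 2) ((S ^^ 2) f) u
      = complex_of_real ((m u - 2 * mass 1 u + mass 2 u) / m u) * f u" if "f \<in> ell2 X" for f u
  proof (cases "u \<in> X")
    case True
    have "op_adjoint X S (S f) u = complex_of_real (mass 1 u / m u) * f u"
      using adjoint_shift_diagonal[OF that, of 1] by simp
    moreover have "complex_of_real (m u) \<noteq> 0" using pos[OF True] by simp
    ultimately show ?thesis
      unfolding adjoint_shift_diagonal[OF that, of 2] by (simp add: field_simps)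
  next
    case False
    then show ?thesis
      using that adjoint_shift_diagonal[OF that, of 1] adjoint_shift_diagonal[OF that, of 2]
      by (simp add: ell2_def)
  qed
  show ?thesis
  proof
    assume "two_isometric X S"
    then have "complex_of_real ((m u - 2 * mass 1 u + mass 2 u) / m u) * f u = 0"
      if "f \<in> ell2 X" for f u
      using that unfolding two_isometric_def Let_def eq[OF that, symmetric] by (blast dest: fun_cong)
    \<comment> \<open>The vector \<open>ell2_basis u\<close>, read at the coordinate
      \<open>u\<close>, isolates the multiplier.\<close>
    from this[OF ell2_basis_mem]
    have "(m u - 2 * mass 1 u + mass 2 u) / m u = 0" if "u \<in> X" for u
      using that by (fastforce simp: ell2_basis_def simp del: of_real_divide)
    then show "\<forall>u\<in>X. m u - 2 * mass 1 u + mass 2 u = 0"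
      using pos by force
  next
    assume *: "\<forall>u\<in>X. m u - 2 * mass 1 u + mass 2 u = 0"
    show "two_isometric X S"
      unfolding two_isometric_def Let_def
    proof (intro ballI ext)
      fix f u assume f: "f \<in> ell2 X"
      show "f u - 2 * op_adjoint X S (S f) u + (op_adjoint X S ^^ 2) ((S ^^ 2) f) u = 0"
        unfolding eq[OF f] using * f by (cases "u \<in> X") (auto simp: ell2_def)
    qed
  qed
qed

text \<open>The operator is multiplication by the real function \<open>q n\<close>, so its quadratic
  form is real, and its sign is governed by the values of \<open>q n\<close>, which basis vectors
  pick out one by one.\<close>

lemma completely_hyperexpansive_iff:
  "completely_hyperexpansive X S \<longleftrightarrow>
     (\<forall>n\<ge>1. \<forall>u\<in>X. (\<Sum>k\<le>n. (-1) ^ k * of_nat (n choose k) * mass k u) \<le> 0)"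
proof -
  define q where "q n u = (\<Sum>k\<le>n. (-1) ^ k * of_nat (n choose k) * mass k u) / m u" for n u
  have eq: "(\<Sum>k\<le>n. (-1) ^ k * of_nat (n choose k) * (op_adjoint X S ^^ k) ((S ^^ k) f) u)
      = complex_of_real (q n u) * f u" if "f \<in> ell2 X" for f u n
    unfolding adjoint_shift_diagonal[OF that] q_def
    by (simp add: sum_distrib_right sum_divide_distrib mult.assoc)
  have inner: "ell2_inner X
      (\<lambda>x. \<Sum>k\<le>n. (-1) ^ k * of_nat (n choose k) * (op_adjoint X S ^^ k) ((S ^^ k) f) x) f
      = complex_of_real (\<Sum>\<^sub>\<infinity>x\<in>X. q n x * (cmod (f x))\<^sup>2)" if "f \<in> ell2 X" for f n
    unfolding eq[OF that] ell2_inner_def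
    by (simp add: mult.assoc complex_norm_square flip: infsum_complex_of_real del: of_real_power)
  have q_iff: "q n u \<le> 0 \<longleftrightarrow> (\<Sum>k\<le>n. (-1) ^ k * of_nat (n choose k) * mass k u) \<le> 0"
    if "u \<in> X" for n u
    using pos[OF that] by (simp add: q_def divide_le_0_iff)
  have "nonpositive_op X
      (\<lambda>f x. \<Sum>k\<le>n. (-1) ^ k * of_nat (n choose k) * (op_adjoint X S ^^ k) ((S ^^ k) f) x)
      \<longleftrightarrow> (\<forall>u\<in>X. q n u \<le> 0)" for n
  proof
    assume *: "nonpositive_op X
      (\<lambda>f x. \<Sum>k\<le>n. (-1) ^ k * of_nat (n choose k) * (op_adjoint X S ^^ k) ((S ^^ k) f) x)"
    show "\<forall>u\<in>X. q n u \<le> 0"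
    proof
      fix u assume u: "u \<in> X"
      have "(\<Sum>\<^sub>\<infinity>x\<in>X. q n x * (cmod (ell2_basis u x))\<^sup>2) = (\<Sum>\<^sub>\<infinity>x\<in>{u}. q n x)"
        using u by (intro infsum_cong_neutral) (auto simp: ell2_basis_def)
      moreover have "(\<Sum>\<^sub>\<infinity>x\<in>X. q n x * (cmod (ell2_basis u x))\<^sup>2) \<le> 0"
        using *[unfolded nonpositive_op_def, rule_format, OF ell2_basis_mem[OF u]]
        unfolding inner[OF ell2_basis_mem[OF u]] Re_complex_of_real by blast
      ultimately show "q n u \<le> 0" by simp
    qed
  next
    assume q: "\<forall>u\<in>X. q n u \<le> 0"
    \<comment> \<open>The sign of the terms decides; a divergent sum would be 0 by default.\<close>
    have "(\<Sum>\<^sub>\<infinity>x\<in>X. q n x * (cmod (f x))\<^sup>2) \<le> 0" for f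
    proof -
      have "0 \<le> (\<Sum>\<^sub>\<infinity>x\<in>X. - (q n x * (cmod (f x))\<^sup>2))"
        by (rule infsum_nonneg) (use q in \<open>simp add: mult_nonpos_nonneg\<close>)
      then show ?thesis by (simp only: infsum_uminus neg_0_le_iff_le)
    qed
    then show "nonpositive_op X
      (\<lambda>f x. \<Sum>k\<le>n. (-1) ^ k * of_nat (n choose k) * (op_adjoint X S ^^ k) ((S ^^ k) f) x)"
      unfolding nonpositive_op_def by (simp add: inner)
  qed
  then show ?thesis
    unfolding completely_hyperexpansive_def Let_def using q_iff by simp
qed

section \<open>The two implications, proved for the masses\<close>

lemma two_isometric_imp_completely_hyperexpansive:
  assumes "two_isometric X S"
  shows "completely_hyperexpansive X S"
  unfolding completely_hyperexpansive_iff
proof (intro allI impI ballI)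
  fix n :: nat and u assume n: "1 \<le> n" and u: "u \<in> X"
  \<comment> \<open>The identity of \<open>two_isometric_iff\<close> at the points of
    \<open>fibre j u\<close>, summed over that fibre, shifts the index by \<open>j\<close>.\<close>
  have step: "mass (2 + j) u = 2 * mass (1 + j) u - mass (0 + j) u" for j
  proof -
    have "(\<Sum>\<^sub>\<infinity>v\<in>fibre j u. mass 2 v) = (\<Sum>\<^sub>\<infinity>v\<in>fibre j u. 2 * mass 1 v - mass 0 v)"
      using assms unfolding two_isometric_iff
      by (intro infsum_cong) (force simp: fibre_def mass_0)
    also have "\<dots> = 2 * (\<Sum>\<^sub>\<infinity>v\<in>fibre j u. mass 1 v) - (\<Sum>\<^sub>\<infinity>v\<in>fibre j u. mass 0 v)"
      using summable_mass[OF u]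
      by (subst infsum_diff) (auto intro: summable_on_cmult_right simp: infsum_cmult_right)
    finally show ?thesis by (simp only: mass_add[OF u])
  qed
  define d where "d = mass 1 u - m u"
  \<comment> \<open>Two consecutive values are carried along because the recurrence has order
    two.\<close>
  have affine: "mass k u = m u + real k * d \<and> mass (Suc k) u = m u + real (Suc k) * d" for k
  proof (induction k)
    case 0
    show ?case using mass_0[OF u] by (simp add: d_def)
  next
    case (Suc k)
    then show ?case using step[of k] by (simp add: algebra_simps)
  qed
  \<comment> \<open>A negative slope would eventually make the masses negative.\<close>
  have "d \<ge> 0"
  proof (rule ccontr)
    assume "\<not> d \<ge> 0"
    then obtain k where "m u < real k * (- d)" using reals_Archimedean3[of "- d"] by auto
    then show False using affine[of k] mass_nonneg[of k u] by simp
  qed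
  \<comment> \<open>The alternating binomial sum kills constants for \<open>n \<ge> 1\<close> and
    linear terms for \<open>n \<ge> 2\<close>; at \<open>n = 1\<close> the linear term leaves
    \<open>- d\<close>.\<close>
  have "(\<Sum>k\<le>n. (-1) ^ k * of_nat (n choose k) * mass k u)
      = m u * (\<Sum>k\<le>n. (-1) ^ k * of_nat (n choose k))
        + d * (\<Sum>k\<le>n. (-1) ^ k * (of_nat k * of_nat (n choose k)))"
    using affine by (simp add: sum_distrib_left distrib_left sum.distrib mult_ac)
  also have "(\<Sum>k\<le>n. (-1) ^ k * of_nat (n choose k)) = (0 :: real)"
    using n by (intro choose_alternating_sum) auto
  also have "d * (\<Sum>k\<le>n. (-1) ^ k * (of_nat k * of_nat (n choose k))) \<le> 0"
  proof (cases "n = 1")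
    case True
    then show ?thesis using \<open>d \<ge> 0\<close> by simp
  next
    case False
    then show ?thesis using n choose_alternating_linear_sum[of n, where ?'a = real]
      by (simp add: mult.assoc)
  qed
  finally show "(\<Sum>k\<le>n. (-1) ^ k * of_nat (n choose k) * mass k u) \<le> 0" by simp
qed

text \<open>The cases \<open>n = 1\<close> and \<open>n = 2\<close> at the points of
  \<open>fibre k u\<close>, summed over that fibre, pass from index 0 to index \<open>k\<close> by
  \<open>mass_add\<close>.\<close>

lemma
  assumes "completely_hyperexpansive X S" and u: "u \<in> X"
  shows mass_mono: "mass k u \<le> mass (Suc k) u"
    and mass_concave: "mass (Suc (Suc k)) u - mass (Suc k) u \<le> mass (Suc k) u - mass k u"
proof -
  have che: "(\<Sum>k\<le>n. (-1) ^ k * of_nat (n choose k) * mass k v) \<le> 0" if "1 \<le> n" "v \<in> X" for n v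
    using assms(1) that by (simp add: completely_hyperexpansive_iff)
  have 1: "mass 0 v \<le> mass 1 v" if "v \<in> X" for v
    using che[of 1 v] that by simp
  have 2: "mass 0 v + mass 2 v \<le> 2 * mass 1 v" if "v \<in> X" for v
    using che[of 2 v] that by (simp add: numeral_2_eq_2)
  have "(\<Sum>\<^sub>\<infinity>v\<in>fibre k u. mass 0 v) \<le> (\<Sum>\<^sub>\<infinity>v\<in>fibre k u. mass 1 v)"
    using summable_mass[OF u] by (intro infsum_mono 1) (auto simp: fibre_def)
  then show "mass k u \<le> mass (Suc k) u" by (simp flip: mass_add[OF u])
  have "(\<Sum>\<^sub>\<infinity>v\<in>fibre k u. mass 0 v + mass 2 v) \<le> (\<Sum>\<^sub>\<infinity>v\<in>fibre k u. 2 * mass 1 v)"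
    using summable_mass[OF u]
    by (intro infsum_mono 2 summable_on_add summable_on_cmult_right) (auto simp: fibre_def)
  then have "mass (0 + k) u + mass (2 + k) u \<le> 2 * mass (1 + k) u"
    unfolding mass_add[OF u] using summable_mass[OF u]
    by (simp add: infsum_add infsum_cmult_right)
  then show "mass (Suc (Suc k)) u - mass (Suc k) u \<le> mass (Suc k) u - mass k u" by simp
qed

lemma
  assumes che: "completely_hyperexpansive X S" and w: "w \<in> X"
    and K: "0 < K" "(T ^^ K) w = w"
  shows affine_periodic: "m w - 2 * mass 1 w + mass 2 w = 0"
    and affine_preperiodic: "\<lbrakk>x \<in> X; (T ^^ K) x = w; x \<noteq> w\<rbrakk> \<Longrightarrow> m x - 2 * mass 1 x + mass 2 x = 0"
proof -
  let ?A = "fibre K w - {w}"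
  \<comment> \<open>The mass gained over \<open>w\<close> in one period: \<open>w\<close> lies in
    its own \<open>K\<close>-fibre and accounts for the summand \<open>mass k w\<close>.\<close>
  define c where "c k = (\<Sum>\<^sub>\<infinity>x\<in>?A. mass k x)" for k
  have sA: "mass k summable_on ?A" for k
    using summable_mass[OF w] by (rule summable_on_subset_banach) auto
  have AX: "x \<in> X" if "x \<in> ?A" for x using that by (auto simp: fibre_def)
  have wF: "w \<in> fibre K w" using w K by (simp add: fibre_def)
  have rec: "mass (k + K) w = mass k w + c k" for k
  proof -
    have "c k = (\<Sum>\<^sub>\<infinity>x\<in>fibre K w. mass k x) - (\<Sum>\<^sub>\<infinity>x\<in>{w}. mass k x)"
      unfolding c_def using wF summable_mass[OF w] by (intro infsum_Diff) auto
    then show ?thesis by (simp add: mass_add[OF w])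
  qed
  define \<delta> where "\<delta> k = mass (Suc k) w - mass k w" for k
  have "\<delta> (Suc k) \<le> \<delta> k" for k
    using mass_concave[OF che w] by (simp add: \<delta>_def)
  then have anti: "i \<le> j \<Longrightarrow> \<delta> j \<le> \<delta> i" for i j
    by (rule lift_Suc_antimono_le)
  have c_mono: "c k \<le> c (Suc k)" for k
    unfolding c_def by (intro infsum_mono sA mass_mono[OF che] AX)
  have \<delta>_K: "\<delta> (k + K) = \<delta> k + (c (Suc k) - c k)" for k
    using rec[of k] rec[of "Suc k"] by (simp add: \<delta>_def)
  \<comment> \<open>Concavity gives \<open>\<delta> (k + K) \<le> \<delta> k\<close>, so
    \<open>c\<close> cannot increase; by \<open>c_mono\<close> it cannot decrease.\<close>
  have c_const: "c (Suc k) = c k" for k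
    using anti[of k "k + K"] \<delta>_K[of k] c_mono[of k] by simp
  \<comment> \<open>Now \<open>\<delta> K = \<delta> 0\<close>, and \<open>1 \<le> K\<close>
    squeezes \<open>\<delta> 1\<close> between them.\<close>
  have "\<delta> 0 = \<delta> 1"
    using \<delta>_K[of 0] c_const[of 0] anti[of 0 1] anti[of 1 K] K(1) by simp
  then show "m w - 2 * mass 1 w + mass 2 w = 0"
    using mass_0[OF w] by (simp add: \<delta>_def numeral_2_eq_2)
  assume x: "x \<in> X" "(T ^^ K) x = w" "x \<noteq> w"
  have const: "mass (Suc k) x = mass k x" for k
  proof -
    have "(\<Sum>\<^sub>\<infinity>y\<in>?A. mass (Suc k) y - mass k y) = 0"
      using c_const[of k] by (simp add: infsum_diff sA c_def)
    \<comment> \<open>The summands are nonnegative by \<open>mass_mono\<close>, so a zero sum forces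
      each to vanish.\<close>
    then have "mass (Suc k) x - mass k x = 0"
      using x mass_mono[OF che AX]
      by (intro nonneg_infsum_le_0D[where A = ?A] summable_on_diff sA) (auto simp: fibre_def)
    then show ?thesis by simp
  qed
  show "m x - 2 * mass 1 x + mass 2 x = 0"
    using const[of 0] const[of 1] mass_0[OF x(1)] by (simp add: numeral_2_eq_2)
qed

text \<open>Each \<open>x\<close> gets its own periodic point \<open>y = T^L x\<close>. Since
  \<open>n \<le> L\<close> and \<open>K\<close> divides \<open>L\<close>, \<open>y\<close> lies on
  the orbit of \<open>w\<close> and is fixed by \<open>T^L\<close>; so \<open>x\<close> is
  \<open>y\<close> itself or falls under \<open>affine_preperiodic\<close> over \<open>y\<close>
  with period \<open>L\<close>.\<close>

lemma completely_hyperexpansive_imp_two_isometric: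
  assumes che: "completely_hyperexpansive X S"
    and w: "w \<in> X" "0 < K" "(T ^^ K) w = w"
    and reach: "\<And>x. x \<in> X \<Longrightarrow> \<exists>n. (T ^^ n) x = w"
  shows "two_isometric X S"
  unfolding two_isometric_iff
proof
  fix x assume x: "x \<in> X"
  obtain n where n: "(T ^^ n) x = w" using reach[OF x] by blast
  \<comment> \<open>A multiple of the period that is at least the preperiod of \<open>x\<close>.\<close>
  define L where "L = Suc n * K"
  define y where "y = (T ^^ L) x"
  have per: "(T ^^ (j * K)) w = w" for j
    by (induction j) (simp_all add: funpow_add w(3))
  have "n \<le> L" using w(2) by (simp add: L_def trans_le_add2)
  then have "y = (T ^^ (L - n + n)) x" by (simp add: y_def)
  then have y_eq: "y = (T ^^ (L - n)) w" by (simp only: funpow_add o_apply n)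
  have "(T ^^ L) y = (T ^^ (L + (L - n))) w" by (simp only: y_eq funpow_add o_apply)
  also have "\<dots> = (T ^^ (L - n)) ((T ^^ L) w)" by (simp only: add.commute[of L] funpow_add o_apply)
  finally have y: "(T ^^ L) y = y" using per[of "Suc n"] y_eq by (simp add: L_def)
  have "y \<in> X" "0 < L" using funpow_mem[OF x] w(2) by (simp_all add: y_def L_def)
  then show "m x - 2 * mass 1 x + mass 2 x = 0"
    using affine_periodic[OF che _ _ y] affine_preperiodic[OF che _ _ y x] y_def by metis
qed

end

section \<open>Application to \<open>weighted_shift\<close> and the graph of
  \<open>T\<close>\<close>

lemma weighted_self_map_weighted_shift:
  assumes M: "discrete_measure_space M" and T: "T \<in> space M \<rightarrow> space M"
    and h: "h_fun M T \<in> Linfty M"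
  shows "weighted_self_map (space M) T (\<lambda>x. measure M {x}) (weighted_shift M T)"
proof
  note ex1 = weighted_shift_ex1[OF M T h]
  show "T \<in> space M \<rightarrow> space M" by (rule T)
  show "bounded_op (space M) (weighted_shift M T)"
    using theI'[OF ex1(1), folded weighted_shift_def] by blast
  show "0 < measure M {x}" if "x \<in> space M" for x
    using M that unfolding discrete_measure_space_def measure_def
    by (auto simp: enn2real_positive_iff)
  show "weighted_shift M T f v =
      complex_of_real (sqrt (measure M {v}) / sqrt (measure M {T v})) * f (T v)"
    if "f \<in> ell2 (space M)" "v \<in> space M" for f v
    unfolding ex1(2) using that by (simp add: weight_def)
qed

text \<open>Edges run from \<open>T x\<close> to \<open>x\<close>, so \<open>T\<close> traverses the
  cycle backwards, from \<open>v 0\<close> to \<open>v (\<kappa> - 1)\<close> and down to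
  \<open>v 0\<close> again.\<close>

lemma one_cycle_type_periodic:
  assumes "one_cycle_type (space M) (graph_edges M T)"
  obtains w K where "w \<in> space M" "0 < K" "(T ^^ K) w = w"
proof -
  obtain \<kappa> :: nat and v where \<kappa>: "\<kappa> \<ge> 1" "v ` {..<\<kappa>} \<subseteq> space M"
    and e: "\<And>j. j + 1 < \<kappa> \<Longrightarrow> (v j, v (j + 1)) \<in> graph_edges M T"
      "(v (\<kappa> - 1), v 0) \<in> graph_edges M T"
    using assms unfolding one_cycle_type_def by blast
  have "(T ^^ j) (v j) = v 0" if "j < \<kappa>" for j
    using that
  proof (induction j)
    case (Suc j)
    then have "T (v (Suc j)) = v j" using e(1)[of j] by (auto simp: graph_edges_def)
    then show ?case using Suc by (simp add: funpow_swap1)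
  qed simp
  from this[of "\<kappa> - 1"] have "(T ^^ (\<kappa> - 1)) (T (v 0)) = v 0"
    using \<kappa>(1) e(2) by (auto simp: graph_edges_def)
  then have "(T ^^ \<kappa>) (v 0) = v 0"
    using \<kappa>(1) by (cases \<kappa>) (simp_all add: funpow_swap1)
  moreover have "v 0 \<in> space M" using \<kappa> by auto
  ultimately show thesis using that[of "v 0" \<kappa>] \<kappa>(1) by simp
qed

text \<open>Induction along an undirected path from \<open>w\<close>. Moving to a preimage costs one
  more iteration, moving to the image one less; adding the period \<open>K\<close> first keeps the
  exponent positive in the latter case.\<close>

lemma connected_reaches_periodic:
  assumes conn: "graph_connected (space M) (graph_edges M T)"
    and w: "w \<in> space M" "0 < K" "(T ^^ K) w = w" and x: "x \<in> space M"
  shows "\<exists>n. (T ^^ n) x = w"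
proof -
  have "(w, x) \<in> (graph_edges M T \<union> (graph_edges M T)\<inverse>)\<^sup>*"
    using conn w(1) x unfolding graph_connected_def by (cases "w = x") auto
  then show ?thesis
  proof (induction rule: rtrancl_induct)
    case base
    show ?case by (rule exI[of _ 0]) simp
  next
    case (step y z)
    then obtain n where n: "(T ^^ n) y = w" by blast
    then have n': "(T ^^ (n + K)) y = w"
      using w(3) by (simp add: add.commute[of n] funpow_add)
    from step(2) have "T z = y \<or> T y = z" by (auto simp: graph_edges_def)
    then show ?case
    proof
      assume "T z = y"
      then have "(T ^^ Suc n) z = w" using n by (simp add: funpow_swap1)
      then show ?case ..
    next
      assume z: "T y = z"
      obtain l where "n + K = Suc l" using w(2) by (cases "n + K") auto
      then have "(T ^^ l) z = w" using n' z by (simp add: funpow_swap1)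
      then show ?case ..
    qed
  qed
qed

theorem theorem5p6:
  fixes M :: "'a measure" and T :: "'a \<Rightarrow> 'a"
  assumes "discrete_measure_space M"
    and "T \<in> space M \<rightarrow> space M"
    and "h_fun M T \<in> Linfty M"
    and "graph_connected (space M) (graph_edges M T)"
    and "one_cycle_type (space M) (graph_edges M T)"
  shows "two_isometric (space M) (weighted_shift M T) \<longleftrightarrow>
         completely_hyperexpansive (space M) (weighted_shift M T)"
proof -
  interpret weighted_self_map "space M" T "\<lambda>x. measure M {x}" "weighted_shift M T"
    by (rule weighted_self_map_weighted_shift[OF assms(1-3)])
  obtain w K where w: "w \<in> space M" "0 < K" "(T ^^ K) w = w"
    using one_cycle_type_periodic[OF assms(5)] by blast
  show ?thesis
    using two_isometric_imp_completely_hyperexpansive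
      completely_hyperexpansive_imp_two_isometric[OF _ w
        connected_reaches_periodic[OF assms(4) w]] by blast
qed

end
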